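(* Let $\{A,B,C\}$ be the three-point metric space with distances $|AB|=1/2$, $|AC|=1/2$, $|BC|=2/3$. The two-point subspace $\{A,B\}$ can be isometrically embedded into $\mathcal{M}$ in such a way that this embedding cannot be extended to an isometric embedding of $\{A,B,C\}$ into $\mathcal{M}$. Consequently, $\mathcal{M}$ is not universal in the strong sense for the family of compact metric spaces.
   Context: $\mathcal{M}$ is the set of isometry classes of (nonempty) compact metric spaces, endowed with the Gromov--Hausdorff metric $d_{GH}$. An isometric embedding is a distance-preserving map. $\mathcal{M}$ is called universal in the strong sense for the family of compact metric spaces if every compact metric space can be isometrically embedded into $\mathcal{M}$ and, in addition, every isometric embedding into $\mathcal{M}$ of a subspace of a compact metric space can be extended to an isometric embedding of the whole space into $\mathcal{M}$. *)

theory Defs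
  imports "HOL-Analysis.Analysis"
begin

definition isometric_embedding ::
    "'a metric \<Rightarrow> 'b set \<Rightarrow> ('b \<Rightarrow> 'b \<Rightarrow> real) \<Rightarrow> ('a \<Rightarrow> 'b) \<Rightarrow> bool" where
  "isometric_embedding X M d f \<longleftrightarrow>
     f \<in> mspace X \<rightarrow> M \<and> (\<forall>x\<in>mspace X. \<forall>y\<in>mspace X. d (f x) (f y) = mdist X x y)"

definition isometric :: "'a metric \<Rightarrow> 'b metric \<Rightarrow> bool" where
  "isometric X Y \<longleftrightarrow>
     (\<exists>f. isometric_embedding X (mspace Y) (mdist Y) f \<and> f ` mspace X = mspace Y)"

abbreviation compact_metric_space :: "'a metric \<Rightarrow> bool" where
  "compact_metric_space X \<equiv> compact_space (mtopology_of X)"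

definition Hausdorff_dist :: "'a metric \<Rightarrow> 'a set \<Rightarrow> 'a set \<Rightarrow> real" where
  "Hausdorff_dist Z S T =
     Inf {r. 0 < r \<and> S \<subseteq> (\<Union>t\<in>T. mball_of Z t r) \<and> T \<subseteq> (\<Union>s\<in>S. mball_of Z s r)}"

text \<open>
  The ambient space of two embedded copies may be shrunk to their union without changing the
  Hausdorff distance, and that union injects into the sum type. So letting the ambient spaces
  range over the metric spaces with points in the sum type loses no generality.
\<close>

definition Gromov_Hausdorff_dist :: "'a metric \<Rightarrow> 'b metric \<Rightarrow> real" where
  "Gromov_Hausdorff_dist X Y =
     Inf {Hausdorff_dist Z (f ` mspace X) (g ` mspace Y) | (Z :: ('a + 'b) metric) f g.
            isometric_embedding X (mspace Z) (mdist Z) f \<and>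
            isometric_embedding Y (mspace Z) (mdist Z) g}"

lemma isometric_refl: "isometric X X"
  unfolding isometric_def isometric_embedding_def by (rule exI[of _ id]) auto

lemma isometric_embedding_comp:
  assumes "isometric_embedding X (mspace Y) (mdist Y) f" "isometric_embedding Y M d g"
  shows "isometric_embedding X M d (g \<circ> f)"
  using assms by (auto simp: isometric_embedding_def Pi_iff)

lemma isometric_trans:
  assumes "isometric X Y" "isometric Y Z"
  shows "isometric X Z"
proof -
  from assms obtain f g where
    f: "isometric_embedding X (mspace Y) (mdist Y) f" "f ` mspace X = mspace Y" and
    g: "isometric_embedding Y (mspace Z) (mdist Z) g" "g ` mspace Y = mspace Z"
    unfolding isometric_def by blast
  have "(g \<circ> f) ` mspace X = mspace Z"
    using f(2) g(2) by (metis image_comp)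
  with isometric_embedding_comp[OF f(1) g(1)] show ?thesis
    unfolding isometric_def by blast
qed

lemma isometric_sym:
  assumes "isometric X Y"
  shows "isometric Y X"
proof -
  from assms obtain f where
    f: "isometric_embedding X (mspace Y) (mdist Y) f" "f ` mspace X = mspace Y"
    unfolding isometric_def by blast
  define g where "g = inv_into (mspace X) f"
  have gX: "g y \<in> mspace X" and fg: "f (g y) = y" if "y \<in> mspace Y" for y
    using that f(2) unfolding g_def by (auto intro: inv_into_into f_inv_into_f)
  have d: "mdist Y (f x) (f x') = mdist X x x'" if "x \<in> mspace X" "x' \<in> mspace X" for x x'
    using f(1) that by (simp add: isometric_embedding_def)
  have "mspace X \<subseteq> g ` mspace Y"
  proof
    fix x assume x: "x \<in> mspace X"
    have y: "f x \<in> mspace Y"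
      using x f(2) by blast
    have "mdist X (g (f x)) x = mdist Y (f (g (f x))) (f x)"
      using d[OF gX[OF y] x] by simp
    also have "\<dots> = 0"
      using fg[OF y] y by (simp add: mdist_zero)
    finally have "g (f x) = x"
      using gX[OF y] x by (simp add: mdist_zero)
    with y show "x \<in> g ` mspace Y"
      by (metis imageI)
  qed
  moreover have "isometric_embedding Y (mspace X) (mdist X) g"
    using gX fg d unfolding isometric_embedding_def by (metis Pi_I)
  ultimately show ?thesis
    using gX unfolding isometric_def by blast
qed

lemma Gromov_Hausdorff_dist_isometric_le:
  assumes "isometric X X'" "isometric Y Y'"
  shows "{Hausdorff_dist Z (f ` mspace X') (g ` mspace Y') | (Z :: 'c metric) f g.
            isometric_embedding X' (mspace Z) (mdist Z) f \<and>
            isometric_embedding Y' (mspace Z) (mdist Z) g}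
       \<subseteq> {Hausdorff_dist Z (f ` mspace X) (g ` mspace Y) | (Z :: 'c metric) f g.
            isometric_embedding X (mspace Z) (mdist Z) f \<and>
            isometric_embedding Y (mspace Z) (mdist Z) g}"
proof -
  from assms obtain h k where
    h: "isometric_embedding X (mspace X') (mdist X') h" "h ` mspace X = mspace X'" and
    k: "isometric_embedding Y (mspace Y') (mdist Y') k" "k ` mspace Y = mspace Y'"
    unfolding isometric_def by blast
  have im: "(f \<circ> h) ` mspace X = f ` mspace X'" "(g \<circ> k) ` mspace Y = g ` mspace Y'"
    for f :: "_ \<Rightarrow> 'c" and g :: "_ \<Rightarrow> 'c"
    using h(2) k(2) by (metis image_comp)+
  show ?thesis
    using isometric_embedding_comp[OF h(1)] isometric_embedding_comp[OF k(1)] im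
    by (smt (verit) Collect_mono)
qed

lemma Gromov_Hausdorff_dist_cong:
  fixes X X' :: "'a metric" and Y Y' :: "'b metric"
  assumes "isometric X X'" "isometric Y Y'"
  shows "Gromov_Hausdorff_dist X Y = Gromov_Hausdorff_dist X' Y'"
  unfolding Gromov_Hausdorff_dist_def
  by (intro arg_cong[where f = Inf] subset_antisym Gromov_Hausdorff_dist_isometric_le
        assms isometric_sym)

lemma compact_metric_space_lepoll_real:
  fixes X :: "'a metric"
  assumes "compact_metric_space X"
  shows "mspace X \<lesssim> (UNIV :: real set)"
proof -
  interpret Metric_space "mspace X" "mdist X"
    by (rule Metric_space_mspace_mdist)
  have "mtotally_bounded (mspace X)"
    using assms by (simp add: mtopology_of_def compact_space_eq_mcomplete_mtotally_bounded)
  then have "\<exists>K. finite K \<and> K \<subseteq> mspace X \<and> mspace X \<subseteq> (\<Union>x\<in>K. mball x (inverse (Suc n)))" for n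
    unfolding mtotally_bounded_def by (meson inverse_positive_iff_positive of_nat_0_less_iff zero_less_Suc)
  then obtain K where K: "finite (K n)" "K n \<subseteq> mspace X"
      "mspace X \<subseteq> (\<Union>x\<in>K n. mball x (inverse (Suc n)))" for n
    by metis
  define D where "D = (\<Union>n. K n)"
  have D: "countable D"
    unfolding D_def using K(1) by (simp add: countable_finite)
  define \<Phi> where "\<Phi> x = {prod_encode (to_nat_on D c, n) | c n. c \<in> D \<and> x \<in> mball c (inverse (Suc n))}" for x
  have "inj_on \<Phi> (mspace X)"
  proof (rule inj_onI, rule ccontr)
    fix x y assume x: "x \<in> mspace X" and y: "y \<in> mspace X" and eq: "\<Phi> x = \<Phi> y" and ne: "x \<noteq> y"
    then have "mdist X x y > 0"
      by simp
    then obtain n where n: "inverse (Suc n) < mdist X x y / 2"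
      using reals_Archimedean[of "mdist X x y / 2"] by auto
    obtain c where c: "c \<in> K n" "x \<in> mball c (inverse (Suc n))"
      using K(3)[of n] x by blast
    then have cD: "c \<in> D"
      by (auto simp: D_def)
    with c have "prod_encode (to_nat_on D c, n) \<in> \<Phi> x"
      unfolding \<Phi>_def by blast
    then have "prod_encode (to_nat_on D c, n) \<in> \<Phi> y"
      by (simp only: eq)
    then obtain c' where "c' \<in> D" "to_nat_on D c = to_nat_on D c'" "y \<in> mball c' (inverse (Suc n))"
      unfolding \<Phi>_def by auto
    with cD D have "y \<in> mball c (inverse (Suc n))"
      by (metis inj_on_contraD inj_on_to_nat_on)
    with c n show False
      using triangle[of x c y] x y by (simp add: commute)
  qed
  then have "mspace X \<lesssim> (UNIV :: nat set set)"
    unfolding lepoll_def by blast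
  then show ?thesis
    using nat_sets_eqpoll_reals lepoll_trans2 by blast
qed

text \<open>
  A compact metric space has at most continuum many points, hence every compact metric space,
  whatever the type of its points, is isometric to one whose points are real numbers.
\<close>

lemma compact_metric_space_isometric_real:
  fixes X :: "'a metric"
  assumes "compact_metric_space X"
  shows "\<exists>Y :: real metric. compact_metric_space Y \<and> isometric X Y"
proof -
  obtain h :: "'a \<Rightarrow> real" where h: "inj_on h (mspace X)"
    using compact_metric_space_lepoll_real[OF assms] unfolding lepoll_def by blast
  define k where "k = inv_into (mspace X) h"
  have k: "k (h x) = x" if "x \<in> mspace X" for x
    using h that by (simp add: k_def)
  define Y where "Y = metric (h ` mspace X, \<lambda>a b. mdist X (k a) (k b))"
  interpret X: Metric_space "mspace X" "mdist X"
    by (rule Metric_space_mspace_mdist)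
  have "Metric_space (h ` mspace X) (\<lambda>a b. mdist X (k a) (k b))"
    by unfold_locales (auto simp: k X.commute intro: X.triangle)
  then have Y: "mspace Y = h ` mspace X" "mdist Y = (\<lambda>a b. mdist X (k a) (k b))"
    by (simp_all add: Y_def Metric_space.mspace_metric Metric_space.mdist_metric)
  interpret XY: Metric_space12 "mspace X" "mdist X" "mspace Y" "mdist Y"
    by (rule Metric_space12_mspace_mdist)
  have d: "mdist Y (h x) (h y) = mdist X x y" if "x \<in> mspace X" "y \<in> mspace X" for x y
    using that by (simp add: Y k)
  have "homeomorphic_map (mtopology_of X) (mtopology_of Y) h"
    unfolding mtopology_of_def by (rule XY.isometry_imp_homeomorphic_map) (use d Y in auto)
  then have "compact_metric_space Y"
    using assms homeomorphic_compact_space homeomorphic_map_imp_homeomorphic_space by blast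
  moreover have "isometric X Y"
    unfolding isometric_def isometric_embedding_def using d Y by (intro exI[of _ h]) auto
  ultimately show ?thesis
    by blast
qed

text \<open>The set of isometry classes of nonempty compact metric spaces, as a type.\<close>

quotient_type gh_space = "real metric" / partial:
  "\<lambda>X Y. compact_metric_space X \<and> mspace X \<noteq> {} \<and>
         compact_metric_space Y \<and> mspace Y \<noteq> {} \<and> isometric X Y"
proof (rule part_equivpI)
  define P :: "real metric" where "P = submetric euclidean_metric {0}"
  have "compact_metric_space P"
    unfolding P_def mtopology_of_submetric mtopology_of_euclidean
    by (simp add: compact_space_subtopology)
  moreover have "mspace P \<noteq> {}"
    by (simp add: P_def)
  ultimately show "\<exists>X :: real metric. compact_metric_space X \<and> mspace X \<noteq> {} \<and>
         compact_metric_space X \<and> mspace X \<noteq> {} \<and> isometric X X"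
    using isometric_refl by blast
qed (auto intro!: sympI transpI intro: isometric_sym isometric_trans)

lift_definition gh_dist :: "gh_space \<Rightarrow> gh_space \<Rightarrow> real" is Gromov_Hausdorff_dist
  by (blast intro: Gromov_Hausdorff_dist_cong)

text \<open>
  The space \<open>M\<close> is given by a set and its distance function. By the lemma
  \<open>compact_metric_space_isometric_real\<close>, metrics on sets of reals represent all compact
  metric spaces.
\<close>

definition strongly_universal_for_compact :: "'b set \<Rightarrow> ('b \<Rightarrow> 'b \<Rightarrow> real) \<Rightarrow> bool" where
  "strongly_universal_for_compact M d \<longleftrightarrow>
     (\<forall>X :: real metric. compact_metric_space X \<longrightarrow> (\<exists>f. isometric_embedding X M d f)) \<and>
     (\<forall>(X :: real metric) S f.
        compact_metric_space X \<and> S \<subseteq> mspace X \<and> isometric_embedding (submetric X S) M d f \<longrightarrow>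
        (\<exists>g. isometric_embedding X M d g \<and> (\<forall>x\<in>S. g x = f x)))"

end

theory Submission
  imports Defs
begin

text \<open>
  Send \<open>A\<close> to a point and \<open>B\<close> to a two-point space of diameter 1. The distance from a
  point to a space is half the diameter of that space, so an image of \<open>C\<close> would have diameter
  at most 1. But two spaces of diameter at most 1 have Gromov--Hausdorff distance at most
  \<open>1/2\<close>: in their disjoint union, let every cross distance be \<open>1/2\<close>. Hence the
  distance \<open>2/3\<close> from the image of \<open>B\<close> is not attained.
\<close>

section \<open>Estimates for the Hausdorff distance\<close>

lemma Hausdorff_dist_commute: "Hausdorff_dist Z S T = Hausdorff_dist Z T S"
  unfolding Hausdorff_dist_def by (rule arg_cong[where f = Inf]) blast

text \<open>Open balls need a strict bound, so each radius \<open>c + e\<close> with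
  \<open>0 < e\<close> is admissible, and \<open>e\<close> is then let go to 0.\<close>

lemma Hausdorff_dist_le:
  assumes "0 \<le> c"
    and "\<And>s. s \<in> S \<Longrightarrow> \<exists>t\<in>T. s \<in> mspace Z \<and> t \<in> mspace Z \<and> mdist Z t s \<le> c"
    and "\<And>t. t \<in> T \<Longrightarrow> \<exists>s\<in>S. s \<in> mspace Z \<and> t \<in> mspace Z \<and> mdist Z s t \<le> c"
  shows "Hausdorff_dist Z S T \<le> c"
proof (rule field_le_epsilon)
  fix e :: real assume e: "0 < e"
  show "Hausdorff_dist Z S T \<le> c + e"
    unfolding Hausdorff_dist_def
  proof (rule cInf_lower)
    have "S \<subseteq> (\<Union>t\<in>T. mball_of Z t (c + e))" "T \<subseteq> (\<Union>s\<in>S. mball_of Z s (c + e))"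
      using assms(2,3) e by fastforce+
    then show "c + e \<in> {r. 0 < r \<and> S \<subseteq> (\<Union>t\<in>T. mball_of Z t r) \<and> T \<subseteq> (\<Union>s\<in>S. mball_of Z s r)}"
      using assms(1) e by simp
  qed (auto intro!: bdd_belowI[of _ 0])
qed

text \<open>Boundedness is needed: otherwise the infimum may be that of the empty set, a junk value.\<close>

lemma Hausdorff_dist_greatest:
  assumes S: "S \<subseteq> mspace Z" "S \<noteq> {}" "\<And>x y. x \<in> S \<Longrightarrow> y \<in> S \<Longrightarrow> mdist Z x y \<le> a"
    and T: "T \<subseteq> mspace Z" "T \<noteq> {}" "\<And>x y. x \<in> T \<Longrightarrow> y \<in> T \<Longrightarrow> mdist Z x y \<le> b"
    and c: "\<And>r. 0 < r \<Longrightarrow> S \<subseteq> (\<Union>t\<in>T. mball_of Z t r) \<Longrightarrow> T \<subseteq> (\<Union>s\<in>S. mball_of Z s r) \<Longrightarrow> c \<le> r"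
  shows "c \<le> Hausdorff_dist Z S T"
  unfolding Hausdorff_dist_def
proof (rule cInf_greatest)
  interpret Metric_space "mspace Z" "mdist Z"
    by (rule Metric_space_mspace_mdist)
  obtain s t where st: "s \<in> S" "t \<in> T"
    using S(2) T(2) by blast
  \<comment> \<open>Large enough that one ball around \<open>t\<close> covers \<open>S\<close> and
    one around \<open>s\<close> covers \<open>T\<close>, crossing over by the pair \<open>s\<close>,
    \<open>t\<close>. The 1 makes the bounds strict.\<close>
  define r where "r = \<bar>a\<bar> + \<bar>b\<bar> + mdist Z s t + 1"
  have tS: "mdist Z t x < r" if "x \<in> S" for x
    using triangle[of t s x] S(1,3) T(1) st that commute[of s t] unfolding r_def
    by (smt (verit) subsetD)
  have sT: "mdist Z s x < r" if "x \<in> T" for x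
    using triangle[of s t x] S(1) T(1,3) st that unfolding r_def by (smt (verit) subsetD)
  have "0 < r"
    using nonneg[of s t] unfolding r_def by linarith
  moreover have "S \<subseteq> (\<Union>t\<in>T. mball_of Z t r)"
    using st S(1) T(1) tS by (intro subsetI UN_I[of t]) auto
  moreover have "T \<subseteq> (\<Union>s\<in>S. mball_of Z s r)"
    using st S(1) T(1) sT by (intro subsetI UN_I[of s]) auto
  ultimately show "{r. 0 < r \<and> S \<subseteq> (\<Union>t\<in>T. mball_of Z t r) \<and> T \<subseteq> (\<Union>s\<in>S. mball_of Z s r)} \<noteq> {}"
    by blast
qed (use c in blast)

text \<open>At an admissible radius \<open>r\<close>, both \<open>x\<close> and \<open>y\<close>
  have points of \<open>S\<close> within \<open>r\<close>, and those are at most \<open>a\<close>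
  apart. Thus passing from \<open>S\<close> to \<open>T\<close> raises a diameter bound by at most
  twice the Hausdorff distance.\<close>

lemma mdist_le_Hausdorff_dist:
  assumes S: "S \<subseteq> mspace Z" "S \<noteq> {}" "\<And>x y. x \<in> S \<Longrightarrow> y \<in> S \<Longrightarrow> mdist Z x y \<le> a"
    and T: "T \<subseteq> mspace Z" "T \<noteq> {}" "\<And>x y. x \<in> T \<Longrightarrow> y \<in> T \<Longrightarrow> mdist Z x y \<le> b"
    and xy: "x \<in> T" "y \<in> T"
  shows "mdist Z x y \<le> a + 2 * Hausdorff_dist Z S T"
proof -
  interpret Metric_space "mspace Z" "mdist Z"
    by (rule Metric_space_mspace_mdist)
  \<comment> \<open>Solved for the Hausdorff distance, the bound can be tested against each
    admissible radius.\<close>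
  have "(mdist Z x y - a) / 2 \<le> Hausdorff_dist Z S T"
  proof (rule Hausdorff_dist_greatest[OF S T])
    fix r assume "T \<subseteq> (\<Union>s\<in>S. mball_of Z s r)"
    then have near: "\<exists>s\<in>S. mdist Z s z < r" if "z \<in> T" for z
      using that by force
    obtain s s' where s: "s \<in> S" "mdist Z s x < r" and s': "s' \<in> S" "mdist Z s' y < r"
      using near xy by blast
    have "s \<in> mspace Z" "s' \<in> mspace Z" "x \<in> mspace Z" "y \<in> mspace Z"
      using S(1) T(1) s s' xy by auto
    then have "mdist Z x y \<le> mdist Z s x + (mdist Z s s' + mdist Z s' y)"
      using triangle[of x s y] triangle[of s s' y] commute[of x s] by linarith
    then show "(mdist Z x y - a) / 2 \<le> r"
      using s s' S(3)[of s s'] by simp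
  qed
  then show ?thesis
    by simp
qed

section \<open>Gromov--Hausdorff distance of bounded spaces\<close>

text \<open>\<open>a\<close> and \<open>b\<close> are any upper bounds for the diameters, not
  necessarily attained, so the locale also covers a space known only to be bounded.\<close>

locale bounded_pair =
  fixes X :: "'a metric" and Y :: "'b metric" and a b :: real
  assumes X: "mspace X \<noteq> {}" "\<And>x y. x \<in> mspace X \<Longrightarrow> y \<in> mspace X \<Longrightarrow> mdist X x y \<le> a"
    and Y: "mspace Y \<noteq> {}" "\<And>x y. x \<in> mspace Y \<Longrightarrow> y \<in> mspace Y \<Longrightarrow> mdist Y x y \<le> b"
begin

lemma images_bounded:
  assumes "isometric_embedding X (mspace Z) (mdist Z) f"
    and "isometric_embedding Y (mspace Z) (mdist Z) g"
  shows "f ` mspace X \<subseteq> mspace Z" "f ` mspace X \<noteq> {}"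
    "\<And>x y. x \<in> f ` mspace X \<Longrightarrow> y \<in> f ` mspace X \<Longrightarrow> mdist Z x y \<le> a"
    "g ` mspace Y \<subseteq> mspace Z" "g ` mspace Y \<noteq> {}"
    "\<And>x y. x \<in> g ` mspace Y \<Longrightarrow> y \<in> g ` mspace Y \<Longrightarrow> mdist Z x y \<le> b"
  using assms X Y unfolding isometric_embedding_def by auto

lemma Hausdorff_dist_nonneg:
  assumes "isometric_embedding X (mspace Z) (mdist Z) f"
    and "isometric_embedding Y (mspace Z) (mdist Z) g"
  shows "0 \<le> Hausdorff_dist Z (f ` mspace X) (g ` mspace Y)"
  by (rule Hausdorff_dist_greatest[OF images_bounded[OF assms]]) auto

lemma Gromov_Hausdorff_dist_le:
  fixes Z :: "('a + 'b) metric"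
  assumes "isometric_embedding X (mspace Z) (mdist Z) f"
    and "isometric_embedding Y (mspace Z) (mdist Z) g"
    and "Hausdorff_dist Z (f ` mspace X) (g ` mspace Y) \<le> c"
  shows "Gromov_Hausdorff_dist X Y \<le> c"
  unfolding Gromov_Hausdorff_dist_def
  by (rule cInf_lower2[OF _ assms(3)])
    (use assms(1,2) Hausdorff_dist_nonneg in \<open>auto intro!: bdd_belowI[of _ 0]\<close>)

text \<open>Points of different summands are placed at distance \<open>c\<close>. A detour through
  the other summand has length \<open>2 * c\<close>, which is where the bounds on \<open>a\<close>
  and \<open>b\<close> enter; \<open>0 < c\<close> keeps the summands apart.\<close>

lemma ex_common_space:
  assumes c: "0 < c" "a \<le> 2 * c" "b \<le> 2 * c"
  shows "\<exists>(Z :: ('a + 'b) metric) f g.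
    isometric_embedding X (mspace Z) (mdist Z) f \<and>
    isometric_embedding Y (mspace Z) (mdist Z) g \<and>
    Hausdorff_dist Z (f ` mspace X) (g ` mspace Y) \<le> c"
proof -
  interpret X: Metric_space "mspace X" "mdist X"
    by (rule Metric_space_mspace_mdist)
  interpret Y: Metric_space "mspace Y" "mdist Y"
    by (rule Metric_space_mspace_mdist)
  define d where "d p q = (case p of
      Inl x \<Rightarrow> (case q of Inl y \<Rightarrow> mdist X x y | Inr y \<Rightarrow> c)
    | Inr x \<Rightarrow> (case q of Inl y \<Rightarrow> c | Inr y \<Rightarrow> mdist Y x y))" for p q
  define Z where "Z = metric (mspace X <+> mspace Y, d)"
  have "Metric_space (mspace X <+> mspace Y) d"
  proof
    show "0 \<le> d x y" for x y
      using c by (auto simp: d_def split: sum.splits)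
    show "d x y = d y x" for x y
      by (auto simp: d_def X.commute Y.commute split: sum.splits)
    show "d x y = 0 \<longleftrightarrow> x = y" if "x \<in> mspace X <+> mspace Y" "y \<in> mspace X <+> mspace Y" for x y
      using that c by (auto simp: d_def split: sum.splits)
    show "d x z \<le> d x y + d y z" if "x \<in> mspace X <+> mspace Y" "y \<in> mspace X <+> mspace Y"
      "z \<in> mspace X <+> mspace Y" for x y z
    proof -
      have "mdist X x y \<le> c + c" if "x \<in> mspace X" "y \<in> mspace X" for x y
        using X(2)[OF that] c by simp
      moreover have "mdist Y x y \<le> c + c" if "x \<in> mspace Y" "y \<in> mspace Y" for x y
        using Y(2)[OF that] c by simp
      ultimately show ?thesis
        using that c X.triangle Y.triangle by (auto simp: d_def split: sum.splits)
    qed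
  qed
  then have Z: "mspace Z = mspace X <+> mspace Y" "mdist Z = d"
    by (simp_all add: Z_def Metric_space.mspace_metric Metric_space.mdist_metric)
  have "isometric_embedding X (mspace Z) (mdist Z) Inl"
    "isometric_embedding Y (mspace Z) (mdist Z) Inr"
    by (auto simp: isometric_embedding_def Z d_def)
  moreover have "Hausdorff_dist Z (Inl ` mspace X) (Inr ` mspace Y) \<le> c"
  proof (rule Hausdorff_dist_le)
    show "\<exists>t\<in>Inr ` mspace Y. s \<in> mspace Z \<and> t \<in> mspace Z \<and> mdist Z t s \<le> c"
      if "s \<in> Inl ` mspace X" for s
      using that Y(1) by (auto simp: Z d_def)
    show "\<exists>s\<in>Inl ` mspace X. s \<in> mspace Z \<and> t \<in> mspace Z \<and> mdist Z s t \<le> c"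
      if "t \<in> Inr ` mspace Y" for t
      using that X(1) by (auto simp: Z d_def)
  qed (use c in simp)
  ultimately show ?thesis
    by blast
qed

lemma Gromov_Hausdorff_dist_le_half_diam:
  assumes "0 < c" "a \<le> 2 * c" "b \<le> 2 * c"
  shows "Gromov_Hausdorff_dist X Y \<le> c"
  using ex_common_space[OF assms] Gromov_Hausdorff_dist_le by blast

lemma Gromov_Hausdorff_dist_greatest:
  assumes "\<And>(Z :: ('a + 'b) metric) f g. isometric_embedding X (mspace Z) (mdist Z) f \<Longrightarrow>
    isometric_embedding Y (mspace Z) (mdist Z) g \<Longrightarrow> c \<le> Hausdorff_dist Z (f ` mspace X) (g ` mspace Y)"
  shows "c \<le> Gromov_Hausdorff_dist X Y"
  unfolding Gromov_Hausdorff_dist_def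
proof (rule cInf_greatest)
  show "{Hausdorff_dist Z (f ` mspace X) (g ` mspace Y) | (Z :: ('a + 'b) metric) f g.
      isometric_embedding X (mspace Z) (mdist Z) f \<and>
      isometric_embedding Y (mspace Z) (mdist Z) g} \<noteq> {}"
    \<comment> \<open>This cross distance is admissible whatever \<open>a\<close> and
      \<open>b\<close> are, so the infimum is over a nonempty set.\<close>
    using ex_common_space[of "\<bar>a\<bar> + \<bar>b\<bar> + 1"] by fastforce
qed (use assms in blast)

lemma Gromov_Hausdorff_dist_nonneg: "0 \<le> Gromov_Hausdorff_dist X Y"
  using Gromov_Hausdorff_dist_greatest Hausdorff_dist_nonneg by blast

text \<open>The Hausdorff estimate holds in every ambient space, hence for the infimum. With
  \<open>X\<close> a point, so \<open>a = 0\<close>, it bounds the diameter of \<open>Y\<close> by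
  twice the distance.\<close>

lemma mdist_right_le:
  assumes "x \<in> mspace Y" "y \<in> mspace Y"
  shows "mdist Y x y \<le> a + 2 * Gromov_Hausdorff_dist X Y"
proof -
  have "(mdist Y x y - a) / 2 \<le> Gromov_Hausdorff_dist X Y"
  proof (rule Gromov_Hausdorff_dist_greatest)
    fix Z :: "('a + 'b) metric" and f g
    assume fg: "isometric_embedding X (mspace Z) (mdist Z) f"
      "isometric_embedding Y (mspace Z) (mdist Z) g"
    then show "(mdist Y x y - a) / 2 \<le> Hausdorff_dist Z (f ` mspace X) (g ` mspace Y)"
      using mdist_le_Hausdorff_dist[OF images_bounded[OF fg], of "g x" "g y"] assms
      by (simp add: isometric_embedding_def)
  qed
  then show ?thesis
    by simp
qed

text \<open>The mirror image of \<open>mdist_right_le\<close>, with the two images exchanged; it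
  gives the reversed distance in the counterexample, in place of a symmetry law.\<close>

lemma mdist_left_le:
  assumes "x \<in> mspace X" "y \<in> mspace X"
  shows "mdist X x y \<le> b + 2 * Gromov_Hausdorff_dist X Y"
proof -
  have "(mdist X x y - b) / 2 \<le> Gromov_Hausdorff_dist X Y"
  proof (rule Gromov_Hausdorff_dist_greatest)
    fix Z :: "('a + 'b) metric" and f g
    assume fg: "isometric_embedding X (mspace Z) (mdist Z) f"
      "isometric_embedding Y (mspace Z) (mdist Z) g"
    note bd = images_bounded[OF fg]
    show "(mdist X x y - b) / 2 \<le> Hausdorff_dist Z (f ` mspace X) (g ` mspace Y)"
      using mdist_le_Hausdorff_dist[OF bd(4-6) bd(1-3), of "f x" "f y"] assms fg(1)
      by (simp add: isometric_embedding_def Hausdorff_dist_commute)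
  qed
  then show ?thesis
    by simp
qed

end

text \<open>Two copies embedded by the same map have the same image. \<open>ex_common_space\<close>
  serves to provide one embedding into a space on the sum type.\<close>

lemma Gromov_Hausdorff_dist_self:
  assumes "mspace X \<noteq> {}" "\<And>x y. x \<in> mspace X \<Longrightarrow> y \<in> mspace X \<Longrightarrow> mdist X x y \<le> a"
  shows "Gromov_Hausdorff_dist X X = 0"
proof -
  interpret bounded_pair X X a a
    using assms by unfold_locales
  have "0 < \<bar>a\<bar> + 1" "a \<le> 2 * (\<bar>a\<bar> + 1)"
    by auto
  then obtain Z :: "('a + 'a) metric" and f where f: "isometric_embedding X (mspace Z) (mdist Z) f"
    using ex_common_space by blast
  have "\<exists>t\<in>f ` mspace X. s \<in> mspace Z \<and> t \<in> mspace Z \<and> mdist Z t s \<le> 0" if "s \<in> f ` mspace X" for s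
    using that images_bounded(1)[OF f f] by (metis mdist_zero order_refl subsetD)
  then have "Hausdorff_dist Z (f ` mspace X) (f ` mspace X) \<le> 0"
    by (intro Hausdorff_dist_le) blast+
  then show ?thesis
    using Gromov_Hausdorff_dist_le[OF f f] Gromov_Hausdorff_dist_nonneg by fastforce
qed

section \<open>Compact spaces and their isometry classes\<close>

lemma compact_metric_space_bounded:
  assumes "compact_metric_space X"
  shows "\<exists>a. \<forall>x\<in>mspace X. \<forall>y\<in>mspace X. mdist X x y \<le> a"
proof -
  interpret Metric_space "mspace X" "mdist X"
    by (rule Metric_space_mspace_mdist)
  have "mbounded (mspace X)"
    using assms compactin_imp_mbounded by (simp add: compact_space_def mtopology_of_def)
  then show ?thesis
    unfolding mbounded_alt by blast
qed

lemma finite_imp_compact_metric_space: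
  "finite (mspace X) \<Longrightarrow> compact_metric_space X"
  by (simp add: compact_space_def finite_imp_compactin)

lemma gh_space_cases:
  obtains X :: "real metric"
  where "c = abs_gh_space X" "compact_metric_space X" "mspace X \<noteq> {}"
proof -
  have "\<exists>X. c = abs_gh_space X \<and> compact_metric_space X \<and> mspace X \<noteq> {}"
    by (induct c rule: gh_space.abs_induct) blast
  then show thesis
    using that by blast
qed

lemma gh_dist_abs:
  assumes "compact_metric_space X" "mspace X \<noteq> {}" "compact_metric_space Y" "mspace Y \<noteq> {}"
  shows "gh_dist (abs_gh_space X) (abs_gh_space Y) = Gromov_Hausdorff_dist X Y"
  using assms by (simp add: gh_dist.abs_eq isometric_refl)

text \<open>\<open>p\<close> is the class of a point and \<open>q\<close> that of two points at
  distance 1. Self-distances and both orders are recorded since an isometric embedding must match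
  all ordered pairs.\<close>

lemma gh_space_counterexample:
  obtains p q where "gh_dist p p = 0" "gh_dist q q = 0" "gh_dist p q = 1/2" "gh_dist q p = 1/2"
    "\<And>c. gh_dist p c = 1/2 \<Longrightarrow> gh_dist q c \<le> 1/2"
proof
  define P :: "real metric" where "P = submetric euclidean_metric {0}"
  define Q :: "real metric" where "Q = submetric euclidean_metric {0, 1}"
  have mP: "mspace P = {0}" "\<And>x y. x \<in> mspace P \<Longrightarrow> y \<in> mspace P \<Longrightarrow> mdist P x y \<le> 0"
    and mQ: "mspace Q = {0, 1}" "\<And>x y. x \<in> mspace Q \<Longrightarrow> y \<in> mspace Q \<Longrightarrow> mdist Q x y \<le> 1"
    and dQ: "mdist Q 0 1 = 1"
    by (auto simp: P_def Q_def dist_real_def)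
  have P: "compact_metric_space P" "mspace P \<noteq> {}" and Q: "compact_metric_space Q" "mspace Q \<noteq> {}"
    by (rule finite_imp_compact_metric_space, simp add: mP mQ, simp add: mP mQ)+
  interpret PQ: bounded_pair P Q 0 1
    by unfold_locales (use P Q mP(2) mQ(2) in auto)
  interpret QP: bounded_pair Q P 1 0
    by unfold_locales (use P Q mP(2) mQ(2) in auto)
  let ?p = "abs_gh_space P" and ?q = "abs_gh_space Q"
  show "gh_dist ?p ?p = 0" "gh_dist ?q ?q = 0"
    using P Q mP(2) mQ(2) by (auto simp: gh_dist_abs intro!: Gromov_Hausdorff_dist_self)
  \<comment> \<open>Cross distance 1/2 gives the upper bound; the points 0 and 1 of \<open>Q\<close>
    force \<open>1 \<le> 0 + 2 * gh_dist ?p ?q\<close>.\<close>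
  show "gh_dist ?p ?q = 1/2"
    using PQ.Gromov_Hausdorff_dist_le_half_diam[of "1/2"] PQ.mdist_right_le[of 0 1] dQ mQ(1) P Q
    by (simp add: gh_dist_abs)
  show "gh_dist ?q ?p = 1/2"
    using QP.Gromov_Hausdorff_dist_le_half_diam[of "1/2"] QP.mdist_left_le[of 0 1] dQ mQ(1) P Q
    by (simp add: gh_dist_abs)
  fix c assume c: "gh_dist ?p c = 1/2"
  obtain Z where Z: "c = abs_gh_space Z" "compact_metric_space Z" "mspace Z \<noteq> {}"
    by (rule gh_space_cases)
  \<comment> \<open>A provisional bound, to enter the locale; comparison with the point then
    sharpens it to 1.\<close>
  obtain b where b: "\<And>x y. x \<in> mspace Z \<Longrightarrow> y \<in> mspace Z \<Longrightarrow> mdist Z x y \<le> b"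
    using compact_metric_space_bounded[OF Z(2)] by blast
  interpret PZ: bounded_pair P Z 0 b
    by unfold_locales (use P Z b mP(2) in auto)
  have "mdist Z x y \<le> 1" if "x \<in> mspace Z" "y \<in> mspace Z" for x y
    using PZ.mdist_right_le[OF that] c P Z by (simp add: gh_dist_abs)
  then interpret QZ: bounded_pair Q Z 1 1
    by unfold_locales (use Q Z mQ(2) in auto)
  show "gh_dist ?q c \<le> 1/2"
    using QZ.Gromov_Hausdorff_dist_le_half_diam[of "1/2"] Q Z by (simp add: gh_dist_abs)
qed

section \<open>The three-point space\<close>

text \<open>An image of \<open>C\<close> would lie at 1/2 from \<open>p\<close>, hence at most 1/2
  from \<open>q\<close>, whereas 2/3 is required.\<close>

lemma ex_nonextendable_embedding:
  fixes X :: "'a metric"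
  assumes X: "mspace X = {A, B, C}"
    and d: "mdist X A B = 1/2" "mdist X A C = 1/2" "mdist X B C = 2/3"
  shows "\<exists>f. isometric_embedding (submetric X {A, B}) (UNIV :: gh_space set) gh_dist f \<and>
    \<not> (\<exists>g. isometric_embedding X (UNIV :: gh_space set) gh_dist g \<and> g A = f A \<and> g B = f B)"
proof -
  interpret Metric_space "mspace X" "mdist X"
    by (rule Metric_space_mspace_mdist)
  obtain p q where pq: "gh_dist p p = 0" "gh_dist q q = 0" "gh_dist p q = 1/2" "gh_dist q p = 1/2"
    and far: "\<And>c. gh_dist p c = 1/2 \<Longrightarrow> gh_dist q c \<le> 1/2"
    using gh_space_counterexample by blast
  define f where "f x = (if x = A then p else q)" for x
  have AB: "A \<noteq> B"
    using d X by auto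
  have "isometric_embedding (submetric X {A, B}) (UNIV :: gh_space set) gh_dist f"
    using AB pq d X commute[of B A] by (auto simp: isometric_embedding_def f_def)
  moreover have False
    if "isometric_embedding X (UNIV :: gh_space set) gh_dist g" "g A = f A" "g B = f B" for g
  proof -
    have "gh_dist p (g C) = 1/2" "gh_dist q (g C) = 2/3"
      using that d X AB by (auto simp: isometric_embedding_def f_def)
    then show False
      using far[of "g C"] by simp
  qed
  ultimately show ?thesis
    by blast
qed

text \<open>Refuting universality takes an actual space with real points. Its nonzero distances lie
  between 1/2 and 1, so the triangle inequality is automatic.\<close>

lemma ex_three_point_space:
  "\<exists>X :: real metric. mspace X = {0, 1, 2} \<and>
     mdist X 0 1 = 1/2 \<and> mdist X 0 2 = 1/2 \<and> mdist X 1 2 = 2/3"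
proof -
  define d :: "real \<Rightarrow> real \<Rightarrow> real"
    where "d x y = (if x = y then 0 else if x = 0 \<or> y = 0 then 1/2 else 2/3)" for x y
  interpret Metric_space "{0, 1, 2}" d
    by unfold_locales (auto simp: d_def)
  show ?thesis
    by (rule exI[of _ "metric ({0, 1, 2}, d)"]) (simp add: d_def)
qed

theorem mainTheorem3:
  shows "(\<forall>(X :: 'a metric) A B C.
            mspace X = {A, B, C} \<and>
            mdist X A B = 1/2 \<and> mdist X A C = 1/2 \<and> mdist X B C = 2/3 \<longrightarrow>
            (\<exists>f. isometric_embedding (submetric X {A, B}) (UNIV :: gh_space set) gh_dist f \<and>
                 \<not> (\<exists>g. isometric_embedding X (UNIV :: gh_space set) gh_dist g \<and>
                        g A = f A \<and> g B = f B)))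
       \<and> \<not> strongly_universal_for_compact (UNIV :: gh_space set) gh_dist"
proof (intro conjI allI impI)
  show "\<not> strongly_universal_for_compact (UNIV :: gh_space set) gh_dist"
  proof
    assume univ: "strongly_universal_for_compact (UNIV :: gh_space set) gh_dist"
    obtain X :: "real metric" where X: "mspace X = {0, 1, 2}"
      "mdist X 0 1 = 1/2" "mdist X 0 2 = 1/2" "mdist X 1 2 = 2/3"
      using ex_three_point_space by blast
    obtain f where f: "isometric_embedding (submetric X {0, 1}) (UNIV :: gh_space set) gh_dist f"
      "\<nexists>g. isometric_embedding X (UNIV :: gh_space set) gh_dist g \<and> g 0 = f 0 \<and> g 1 = f 1"
      using ex_nonextendable_embedding[OF X] by blast
    have "compact_metric_space X" "{0, 1} \<subseteq> mspace X"
      using X(1) by (auto intro: finite_imp_compact_metric_space)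
    with univ f(1) obtain g where "isometric_embedding X (UNIV :: gh_space set) gh_dist g"
      "\<forall>x\<in>{0, 1}. g x = f x"
      unfolding strongly_universal_for_compact_def by blast
    with f(2) show False
      by blast
  qed
qed (elim conjE, rule ex_nonextendable_embedding)

end
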